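(* Let $M$ and $k$ be positive integers with $M\geq k\geq 4$, and let $G$ be a finite simple graph with maximum degree $\Delta(G)\leq M$. Then: (1) if $\mathrm{mad}(G)<\frac{12}{5}$, then $\chi^l_k(G)\leq\left\lceil\frac{M}{k-1}\right\rceil+1$; (2) if $\mathrm{mad}(G)<\frac{8}{3}$, then $\chi^l_k(G)\leq\left\lceil\frac{M}{k-1}\right\rceil+2$; (3) if $\mathrm{mad}(G)<3$, then $\chi^l_k(G)\leq\left\lceil\frac{M}{k-1}\right\rceil+3$.
   Context: All graphs are finite, simple and undirected. The maximum average degree of $G$ is $\mathrm{mad}(G)=\max\{2|E(H)|/|V(H)| : H\subseteq G\}$. A $k$-forested coloring of $G$ is a proper vertex coloring such that, for any two color classes, the subgraph induced by the union of these two classes is a forest of maximum degree less than $k$. If $L$ assigns to each vertex $v$ a list $L(v)$ of colors, $G$ is $k$-forested $L$-colorable if it has a $k$-forested coloring in which each vertex $v$ receives a color from $L(v)$; $G$ is $k$-forested $q$-choosable if it is $k$-forested $L$-colorable for every list assignment $L$ with $|L(v)|=q$ for all $v$. The $k$-forested choice number $\chi^l_k(G)$ is the smallest $q$ such that $G$ is $k$-forested $q$-choosable. *)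

theory Defs
  imports Complex_Main
begin

definition simple_graph :: "'a set \<Rightarrow> 'a set set \<Rightarrow> bool" where
  "simple_graph V E \<longleftrightarrow> finite V \<and> (\<forall>e\<in>E. \<exists>u v. u \<noteq> v \<and> u \<in> V \<and> v \<in> V \<and> e = {u, v})"

definition degree :: "'a set set \<Rightarrow> 'a \<Rightarrow> nat" where
  "degree E v = card {u. {u, v} \<in> E}"

definition max_degree_le :: "'a set \<Rightarrow> 'a set set \<Rightarrow> nat \<Rightarrow> bool" where
  "max_degree_le V E M \<longleftrightarrow> (\<forall>v\<in>V. degree E v \<le> M)"

definition subgraph :: "'a set \<Rightarrow> 'a set set \<Rightarrow> 'a set \<Rightarrow> 'a set set \<Rightarrow> bool" where
  "subgraph V' E' V E \<longleftrightarrow> V' \<subseteq> V \<and> E' \<subseteq> E \<and> (\<forall>e\<in>E'. e \<subseteq> V')"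

definition mad :: "'a set \<Rightarrow> 'a set set \<Rightarrow> real" where
  "mad V E = (if V = {} then 0 else
     Max {2 * real (card E') / real (card V') | V' E'. subgraph V' E' V E \<and> V' \<noteq> {}})"

definition induced_edges :: "'a set set \<Rightarrow> 'a set \<Rightarrow> 'a set set" where
  "induced_edges E S = {e \<in> E. e \<subseteq> S}"

definition is_cycle :: "'a set \<Rightarrow> 'a set set \<Rightarrow> 'a list \<Rightarrow> bool" where
  "is_cycle S E cs \<longleftrightarrow> length cs \<ge> 3 \<and> distinct cs \<and> set cs \<subseteq> S
     \<and> (\<forall>i < length cs. {cs ! i, cs ! ((i + 1) mod length cs)} \<in> E)"

definition forest :: "'a set \<Rightarrow> 'a set set \<Rightarrow> bool" where
  "forest S E \<longleftrightarrow> \<not> (\<exists>cs. is_cycle S E cs)"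

definition proper_coloring :: "'a set \<Rightarrow> 'a set set \<Rightarrow> ('a \<Rightarrow> 'c) \<Rightarrow> bool" where
  "proper_coloring V E c \<longleftrightarrow> (\<forall>u\<in>V. \<forall>v\<in>V. {u, v} \<in> E \<longrightarrow> c u \<noteq> c v)"

definition forested_coloring :: "nat \<Rightarrow> 'a set \<Rightarrow> 'a set set \<Rightarrow> ('a \<Rightarrow> 'c) \<Rightarrow> bool" where
  "forested_coloring k V E c \<longleftrightarrow> proper_coloring V E c \<and>
     (\<forall>a b. let S = {v \<in> V. c v = a \<or> c v = b} in
        forest S (induced_edges E S) \<and> (\<forall>v\<in>S. degree (induced_edges E S) v < k))"

definition forested_L_colorable :: "nat \<Rightarrow> 'a set \<Rightarrow> 'a set set \<Rightarrow> ('a \<Rightarrow> nat set) \<Rightarrow> bool" where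
  "forested_L_colorable k V E L \<longleftrightarrow>
     (\<exists>c :: 'a \<Rightarrow> nat. forested_coloring k V E c \<and> (\<forall>v\<in>V. c v \<in> L v))"

definition forested_choosable :: "nat \<Rightarrow> 'a set \<Rightarrow> 'a set set \<Rightarrow> nat \<Rightarrow> bool" where
  "forested_choosable k V E q \<longleftrightarrow>
     (\<forall>L :: 'a \<Rightarrow> nat set. (\<forall>v\<in>V. finite (L v) \<and> card (L v) = q) \<longrightarrow> forested_L_colorable k V E L)"

definition forested_choice_number :: "nat \<Rightarrow> 'a set \<Rightarrow> 'a set set \<Rightarrow> nat" where
  "forested_choice_number k V E = (LEAST q. forested_choosable k V E q)"

end

theory Submission
  imports Defs
begin

text \<open>
  Let \<open>Q = \<lceil>M / (k - 1)\<rceil>\<close>. When a vertex is coloured last, each neighbour \<open>u\<close> forbids its own colour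
  and the colours that already occur \<open>k - 1\<close> times around \<open>u\<close>; as \<open>u\<close> has at most \<open>M - 1\<close> other
  neighbours, there are at most \<open>Q - 1\<close> of the latter, and none if \<open>u\<close> has degree at most 3. Two
  neighbours of the same colour moreover forbid the colours common to their neighbourhoods.
  In a minimal counterexample there are hence no vertices of degree at most 1, and: for lists of size
  \<open>Q + 1\<close>, no 2-vertex has a 2-neighbour and a second neighbour of degree at most 3; for \<open>Q + 2\<close>,
  no two 2-vertices are adjacent and every 3-vertex has at most one 2-neighbour; for \<open>Q + 3\<close>,
  no 2-vertex has a neighbour of degree at most 3, and 4- and 5-vertices have at least two
  neighbours of degree greater than 2. Moving charge from vertices of large degree to their
  2-neighbours then contradicts the bound on the average degree.
\<close>

section \<open>Relative neighbourhoods and saturated colours\<close>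

text \<open>Vertex deletion is expressed by shrinking \<open>W\<close> while \<open>E\<close> stays
  fixed; \<open>v\<close> may lie outside \<open>W\<close>, as does a vertex still to be
  coloured.\<close>

definition nbs :: "'a set set \<Rightarrow> 'a set \<Rightarrow> 'a \<Rightarrow> 'a set" where
  "nbs E W v = {u \<in> W. {u, v} \<in> E}"

text \<open>One more neighbour of colour \<open>a\<close> would raise the degree of \<open>u\<close>
  in the union of the classes \<open>a\<close> and \<open>c u\<close> to at least
  \<open>k\<close>.\<close>

definition saturated :: "nat \<Rightarrow> 'a set set \<Rightarrow> 'a set \<Rightarrow> ('a \<Rightarrow> 'c) \<Rightarrow> 'a \<Rightarrow> 'c set" where
  "saturated k E W c u = {a. k - 1 \<le> card {x \<in> nbs E W u. c x = a}}"

lemma finite_nbs: "finite W \<Longrightarrow> finite (nbs E W v)"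
  by (simp add: nbs_def)

lemma card_2_memE:
  assumes "card A = 2" "x \<in> A"
  obtains y where "A = {x, y}" "y \<noteq> x"
proof -
  obtain a b where ab: "A = {a, b}" "a \<noteq> b"
    using assms(1) unfolding card_2_iff by blast
  show thesis
  proof (cases "x = a")
    case True
    show thesis by (rule that[of b]) (use ab True in auto)
  next
    case False
    then have "x = b" using ab assms by simp
    show thesis by (rule that[of a]) (use ab \<open>x = b\<close> in auto)
  qed
qed

lemma saturated_subset:
  assumes "2 \<le> k"
  shows "saturated k E W c u \<subseteq> c ` nbs E W u"
proof
  fix a assume "a \<in> saturated k E W c u"
  then have "card {x \<in> nbs E W u. c x = a} \<noteq> 0"
    using assms by (simp add: saturated_def)
  then have "{x \<in> nbs E W u. c x = a} \<noteq> {}"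
    by force
  then show "a \<in> c ` nbs E W u" by auto
qed

lemma finite_saturated: "2 \<le> k \<Longrightarrow> finite W \<Longrightarrow> finite (saturated k E W c u)"
  by (meson finite_imageI finite_nbs finite_subset saturated_subset)

text \<open>The colour classes are disjoint inside the neighbourhood of \<open>u\<close>, and each
  saturated one fills at least \<open>k - 1\<close> places there.\<close>

lemma card_saturated_mult_le:
  assumes "2 \<le> k" "finite W"
  shows "card (saturated k E W c u) * (k - 1) \<le> card (nbs E W u)"
proof -
  let ?S = "saturated k E W c u" and ?P = "\<lambda>a. {x \<in> nbs E W u. c x = a}"
  have "card ?S * (k - 1) = (\<Sum>a\<in>?S. k - 1)" by simp
  also have "\<dots> \<le> (\<Sum>a\<in>?S. card (?P a))"
    by (rule sum_mono) (simp add: saturated_def)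
  also have "\<dots> = card (\<Union>a\<in>?S. ?P a)"
    using assms by (subst card_UN_disjoint) (auto simp: finite_saturated finite_nbs)
  also have "\<dots> \<le> card (nbs E W u)"
    by (rule card_mono) (auto simp: assms finite_nbs)
  finally show ?thesis .
qed

section \<open>Extending a forested colouring by one vertex\<close>

text \<open>\<open>u\<close> and \<open>w\<close> are the neighbours of \<open>v\<close> on the
  cycle, \<open>x\<close> and \<open>y\<close> the vertices one step further. The latter coincide in
  a 4-cycle, and in a triangle they are \<open>w\<close> and \<open>u\<close>.\<close>

lemma cycle_around_vertex:
  assumes "is_cycle S E cs" "v \<in> set cs"
  obtains u w x y where "{u, w, x, y} \<subseteq> S - {v}" "u \<noteq> w"
    "{u, v} \<in> E" "{w, v} \<in> E" "{x, u} \<in> E" "{y, w} \<in> E"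
proof -
  let ?n = "length cs"
  have n: "?n \<ge> 3" and d: "distinct cs" and S: "set cs \<subseteq> S"
    and e: "\<And>i. i < ?n \<Longrightarrow> {cs ! i, cs ! ((i + 1) mod ?n)} \<in> E"
    using assms by (auto simp: is_cycle_def)
  obtain i where i: "i < ?n" "v = cs ! i"
    using assms(2) by (auto simp: in_set_conv_nth)
  \<comment> \<open>Cyclic successor and predecessor, by cases instead of \<open>mod\<close>, so
    that inequations between positions become linear arithmetic.\<close>
  define s where "s j = (if j + 1 = ?n then 0 else j + 1)" for j
  define p where "p j = (if j = 0 then ?n - 1 else j - 1)" for j
  have e': "{cs ! j, cs ! s j} \<in> E" if "j < ?n" for j
    using e[OF that] that by (cases "j + 1 = ?n") (auto simp: s_def)
  have lt: "s j < ?n" "p j < ?n" "s (p j) = j" if "j < ?n" for j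
    using that n by (auto simp: s_def p_def)
  have neq: "s i \<noteq> i" "p i \<noteq> i" "s (s i) \<noteq> i" "p (p i) \<noteq> i" "s i \<noteq> p i"
    using i(1) n by (auto simp: s_def p_def split: if_splits)
  have mem: "cs ! j \<in> S - {v}" if "j < ?n" "j \<noteq> i" for j
    using S that i by (auto simp: nth_eq_iff_index_eq[OF d])
  note lt' = lt(1)[OF i(1)] lt(2)[OF i(1)]
  show thesis
  proof (rule that[of "cs ! s i" "cs ! p i" "cs ! s (s i)" "cs ! p (p i)"])
    show "{cs ! s i, cs ! p i, cs ! s (s i), cs ! p (p i)} \<subseteq> S - {v}"
      using mem lt' lt(1)[OF lt'(1)] lt(2)[OF lt'(2)] neq by blast
    show "cs ! s i \<noteq> cs ! p i" using neq(5) lt' by (simp add: nth_eq_iff_index_eq[OF d])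
    show "{cs ! s i, v} \<in> E" using e'[OF i(1)] i(2) by (metis insert_commute)
    show "{cs ! p i, v} \<in> E" using e'[OF lt'(2)] i(2) lt(3)[OF i(1)] by metis
    show "{cs ! s (s i), cs ! s i} \<in> E" using e'[OF lt'(1)] by (metis insert_commute)
    show "{cs ! p (p i), cs ! p i} \<in> E"
      using e'[OF lt(2)[OF lt'(2)]] lt(3)[OF lt'(2)] by metis
  qed
qed

lemma forested_coloringD:
  assumes "forested_coloring k W E c"
  shows "\<And>u v. u \<in> W \<Longrightarrow> v \<in> W \<Longrightarrow> {u, v} \<in> E \<Longrightarrow> c u \<noteq> c v"
    and "\<And>a b. forest {v \<in> W. c v = a \<or> c v = b} (induced_edges E {v \<in> W. c v = a \<or> c v = b})"
    and "\<And>a b v. v \<in> W \<Longrightarrow> c v = a \<or> c v = b \<Longrightarrow>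
      degree (induced_edges E {v \<in> W. c v = a \<or> c v = b}) v < k"
  using assms unfolding forested_coloring_def proper_coloring_def Let_def by blast+

lemma degree_induced_edges: "v \<in> S \<Longrightarrow> degree (induced_edges E S) v = card (nbs E S v)"
  by (auto simp: degree_def induced_edges_def nbs_def intro!: arg_cong[where f = card])

text \<open>A new bicoloured cycle passes through \<open>v\<close>; its two neighbours there share
  the other colour and the vertices beyond them have colour \<open>a\<close> again, which
  \<open>acyclic\<close> excludes. Degrees change only at \<open>v\<close>, bounded by
  \<open>deg\<close>, and at its neighbours, which gain just \<open>v\<close> and have room by
  \<open>unsat\<close>.\<close>

lemma forested_extend:
  assumes c: "forested_coloring k W E c" and "finite W" "v \<notin> W" "{v} \<notin> E"
    and proper: "\<And>u. u \<in> nbs E W v \<Longrightarrow> c u \<noteq> a"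
    and unsat: "\<And>u. u \<in> nbs E W v \<Longrightarrow> a \<notin> saturated k E W c u"
    and deg: "card (nbs E W v) < k"
    and acyclic: "\<And>u w. u \<in> nbs E W v \<Longrightarrow> w \<in> nbs E W v \<Longrightarrow> u \<noteq> w \<Longrightarrow> c u = c w \<Longrightarrow>
      a \<notin> c ` nbs E W u \<inter> c ` nbs E W w"
  shows "forested_coloring k (insert v W) E (c(v := a))"
proof -
  note cD = forested_coloringD[OF c]
  let ?c = "c(v := a)"
  have P: "?c x \<noteq> ?c y" if "x \<in> insert v W" "y \<in> insert v W" "{x, y} \<in> E" for x y
    using that cD(1)[of x y] proper[of x] proper[of y] \<open>{v} \<notin> E\<close>
    by (auto simp: nbs_def insert_commute)
  have proper_ext: "proper_coloring (insert v W) E ?c"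
    using P by (auto simp: proper_coloring_def)
  have forest: "forest S (induced_edges E S)"
    if S: "S = {x \<in> insert v W. ?c x = \<alpha> \<or> ?c x = \<beta>}" for S \<alpha> \<beta>
    unfolding forest_def
  proof
    assume "\<exists>cs. is_cycle S (induced_edges E S) cs"
    then obtain cs where cs: "is_cycle S (induced_edges E S) cs" ..
    show False
    proof (cases "v \<in> set cs")
      case False
      let ?T = "{x \<in> W. c x = \<alpha> \<or> c x = \<beta>}"
      have sub: "set cs \<subseteq> ?T"
        using cs False S by (auto simp: is_cycle_def split: if_splits)
      have "is_cycle ?T (induced_edges E ?T) cs"
        unfolding is_cycle_def
      proof (intro conjI allI impI)
        fix i assume i: "i < length cs"
        then have "(i + 1) mod length cs < length cs"
          by (intro mod_less_divisor) linarith
        then have "{cs ! i, cs ! ((i + 1) mod length cs)} \<subseteq> set cs"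
          using i by simp
        moreover have "{cs ! i, cs ! ((i + 1) mod length cs)} \<in> E"
          using cs i by (auto simp: is_cycle_def induced_edges_def)
        ultimately show "{cs ! i, cs ! ((i + 1) mod length cs)} \<in> induced_edges E ?T"
          using sub by (auto simp: induced_edges_def)
      qed (use cs sub in \<open>auto simp: is_cycle_def\<close>)
      then show False using cD(2)[of \<alpha> \<beta>] by (auto simp: forest_def)
    next
      case True
      then have "v \<in> S" using cs by (auto simp: is_cycle_def)
      obtain u w x y where "{u, w, x, y} \<subseteq> S - {v}" "u \<noteq> w"
        and "{u, v} \<in> induced_edges E S" "{w, v} \<in> induced_edges E S"
          "{x, u} \<in> induced_edges E S" "{y, w} \<in> induced_edges E S"
        using cycle_around_vertex[OF cs True] by metis
      then have E: "{u, v} \<in> E" "{w, v} \<in> E" "{x, u} \<in> E" "{y, w} \<in> E"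
        and W: "u \<in> W" "w \<in> W" "x \<in> W" "y \<in> W" "u \<in> S" "w \<in> S" "x \<in> S" "y \<in> S"
        and neq: "u \<noteq> v" "w \<noteq> v" "x \<noteq> v" "y \<noteq> v"
        using S by (auto simp: induced_edges_def)
      have N: "u \<in> nbs E W v" "w \<in> nbs E W v" "x \<in> nbs E W u" "y \<in> nbs E W w"
        using E W by (auto simp: nbs_def)
      have "a = \<alpha> \<or> a = \<beta>" using \<open>v \<in> S\<close> S by auto
      moreover have "c u \<noteq> a" "c w \<noteq> a" using proper N by auto
      moreover have "c x \<noteq> c u" "c y \<noteq> c w" using cD(1) E W by auto
      moreover have "c u = \<alpha> \<or> c u = \<beta>" "c w = \<alpha> \<or> c w = \<beta>"
          "c x = \<alpha> \<or> c x = \<beta>" "c y = \<alpha> \<or> c y = \<beta>"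
        using W S neq by auto
      ultimately have cuw: "c u = c w" and "a = c x" "a = c y"
        by metis+
      then have "a \<in> c ` nbs E W u \<inter> c ` nbs E W w"
        using N(3,4) by (intro IntI) (rule image_eqI, assumption+)+
      then show False using acyclic[OF N(1,2) \<open>u \<noteq> w\<close> cuw] by simp
    qed
  qed
  have degree: "degree (induced_edges E S) x < k"
    if S: "S = {x \<in> insert v W. ?c x = \<alpha> \<or> ?c x = \<beta>}" and x: "x \<in> S" for S \<alpha> \<beta> x
  proof -
    have *: "degree (induced_edges E S) x = card (nbs E S x)"
      using x by (rule degree_induced_edges)
    consider "x = v" | "x \<noteq> v" "v \<in> S" "{v, x} \<in> E" | "x \<noteq> v" "v \<notin> S \<or> {v, x} \<notin> E" by blast
    then show ?thesis
    proof cases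
      case 1
      have "card (nbs E S x) \<le> card (nbs E W v)"
        using 1 S \<open>{v} \<notin> E\<close> \<open>finite W\<close> by (intro card_mono) (auto simp: nbs_def)
      then show ?thesis using deg * by simp
    next
      case 2
      have xN: "x \<in> nbs E W v" using 2 x S by (auto simp: nbs_def insert_commute)
      \<comment> \<open>As \<open>v\<close> lies in \<open>S\<close>, one of the two colours is
        \<open>a\<close>; \<open>x\<close> has the other one, so by properness all its neighbours in
        \<open>S\<close> are coloured \<open>a\<close>.\<close>
      have "nbs E S x \<subseteq> insert v {y \<in> nbs E W x. c y = a}"
      proof
        fix y assume y: "y \<in> nbs E S x"
        then have "?c y \<noteq> ?c x" using P[of y x] x S by (auto simp: nbs_def)
        then show "y \<in> insert v {y \<in> nbs E W x. c y = a}"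
          using y x 2 S proper[OF xN] by (auto simp: nbs_def split: if_splits)
      qed
      then have "card (nbs E S x) \<le> card (insert v {y \<in> nbs E W x. c y = a})"
        using \<open>finite W\<close> by (intro card_mono) (auto simp: nbs_def)
      also have "\<dots> \<le> Suc (card {y \<in> nbs E W x. c y = a})"
        by (rule card_insert_le_m1) auto
      also have "\<dots> < k" using unsat[OF xN] by (auto simp: saturated_def)
      finally show ?thesis using * by simp
    next
      case 3
      let ?T = "{x \<in> W. c x = \<alpha> \<or> c x = \<beta>}"
      have "x \<in> ?T" using x S 3 by auto
      then have "card (nbs E ?T x) < k"
        using cD(3)[of x \<alpha> \<beta>] degree_induced_edges[of x ?T E] by auto
      moreover have "nbs E S x \<subseteq> nbs E ?T x"
        using S 3 by (auto simp: nbs_def)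
      then have "card (nbs E S x) \<le> card (nbs E ?T x)"
        using \<open>finite W\<close> by (intro card_mono) (auto simp: nbs_def)
      ultimately show ?thesis using * by simp
    qed
  qed
  show ?thesis
    unfolding forested_coloring_def Let_def
    by (intro conjI allI ballI proper_ext forest[OF refl] degree[OF refl])
qed

text \<open>With at most one coloured neighbour no cycle can close through \<open>v\<close>.\<close>

lemma forested_extend_degree_le_1:
  assumes "forested_coloring k W E c" "finite W" "v \<notin> W" "{v} \<notin> E" "2 \<le> k"
    and "card (nbs E W v) \<le> 1"
    and "a \<notin> (\<Union>u \<in> nbs E W v. insert (c u) (saturated k E W c u))"
  shows "forested_coloring k (insert v W) E (c(v := a))"
proof (rule forested_extend)
  fix u w assume "u \<in> nbs E W v" "w \<in> nbs E W v" "u \<noteq> w"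
  then show "a \<notin> c ` nbs E W u \<inter> c ` nbs E W w"
    using assms(6) card_le_Suc0_iff_eq[OF finite_nbs[OF assms(2)]] by (metis One_nat_def)
qed (use assms in auto)

text \<open>If \<open>u\<close> and \<open>w\<close> differ in colour, no bicoloured cycle passes
  through \<open>v\<close>. If they agree, avoiding every colour around \<open>w\<close> excludes
  both the colours common to the two neighbourhoods and those saturated at \<open>w\<close>.\<close>

lemma forested_extend_degree_2:
  assumes c: "forested_coloring k W E c" and "finite W" "v \<notin> W" "{v} \<notin> E" "3 \<le> k"
    and N: "nbs E W v = {u, w}"
    and le: "if c u = c w then 1 + card (saturated k E W c u) + card (nbs E W w) < card L
      else 2 + card (saturated k E W c u) + card (saturated k E W c w) < card L"
  obtains a where "a \<in> L" "forested_coloring k (insert v W) E (c(v := a))"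
proof -
  have k: "2 \<le> k" using \<open>3 \<le> k\<close> by simp
  have finS: "finite (saturated k E W c x)" for x
    using k \<open>finite W\<close> by (rule finite_saturated)
  define F where "F = (if c u = c w then {c u} \<union> saturated k E W c u \<union> c ` nbs E W w
    else {c u, c w} \<union> saturated k E W c u \<union> saturated k E W c w)"
  have "card F < card L"
  proof (cases "c u = c w")
    case True
    have "card F \<le> card {c u} + card (saturated k E W c u) + card (c ` nbs E W w)"
      using True card_Un_le[of "{c u} \<union> saturated k E W c u" "c ` nbs E W w"]
        card_Un_le[of "{c u}" "saturated k E W c u"] by (simp add: F_def)
    moreover have "card (c ` nbs E W w) \<le> card (nbs E W w)"
      by (simp add: card_image_le finite_nbs \<open>finite W\<close>)
    ultimately show ?thesis using le True by simp
  next
    case False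
    have "card F \<le> card {c u, c w} + card (saturated k E W c u) + card (saturated k E W c w)"
      using False card_Un_le[of "{c u, c w} \<union> saturated k E W c u" "saturated k E W c w"]
        card_Un_le[of "{c u, c w}" "saturated k E W c u"] by (simp add: F_def)
    then show ?thesis using le False by simp
  qed
  moreover have "finite F"
    using finS by (simp add: F_def finite_nbs \<open>finite W\<close>)
  ultimately obtain a where a: "a \<in> L" "a \<notin> F"
    by (meson card_mono not_less subsetI)
  have "forested_coloring k (insert v W) E (c(v := a))"
  proof (rule forested_extend[OF c \<open>finite W\<close> \<open>v \<notin> W\<close> \<open>{v} \<notin> E\<close>])
    show "card (nbs E W v) < k"
      using \<open>3 \<le> k\<close> N card_insert_le_m1[of 2 "{w}" u] by simp
    show "a \<notin> saturated k E W c x" if "x \<in> nbs E W v" for x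
      using that a(2) N saturated_subset[OF k, of E W c w] by (auto simp: F_def split: if_splits)
  qed (use a N in \<open>auto simp: F_def split: if_splits\<close>)
  then show thesis using a that by blast
qed

section \<open>Degree sums and discharging\<close>

lemma sum_card_nbs:
  assumes "simple_graph V E" "U \<subseteq> V"
  shows "(\<Sum>v\<in>U. card (nbs E U v)) = 2 * card (induced_edges E U)"
proof -
  have fU: "finite U" using assms finite_subset by (auto simp: simple_graph_def)
  have fE: "finite (induced_edges E U)"
    by (rule finite_subset[of _ "Pow U"]) (auto simp: induced_edges_def fU)
  have "card (nbs E U v) = card {e \<in> induced_edges E U. v \<in> e}" if v: "v \<in> U" for v
  proof (rule bij_betw_same_card[of "\<lambda>u. {u, v}"], rule bij_betw_imageI)
    show "inj_on (\<lambda>u. {u, v}) (nbs E U v)"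
      by (auto simp: inj_on_def doubleton_eq_iff)
    show "(\<lambda>u. {u, v}) ` nbs E U v = {e \<in> induced_edges E U. v \<in> e}" (is "?A = ?B")
    proof
      show "?A \<subseteq> ?B" using v by (auto simp: nbs_def induced_edges_def)
      show "?B \<subseteq> ?A"
      proof
        fix e assume e: "e \<in> ?B"
        then have "e \<in> E" by (simp add: induced_edges_def)
        then obtain x y where "e = {x, y}" using assms by (auto simp: simple_graph_def)
        then have "e = {x, v} \<and> x \<in> U \<or> e = {y, v} \<and> y \<in> U"
          using e by (auto simp: induced_edges_def)
        then show "e \<in> ?A" using \<open>e \<in> E\<close> by (auto simp: nbs_def)
      qed
    qed
  qed
  then have "(\<Sum>v\<in>U. card (nbs E U v)) = (\<Sum>v\<in>U. card {e \<in> induced_edges E U. v \<in> e})"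
    by simp
  also have "\<dots> = 2 * card (induced_edges E U)"
  proof (rule sum_multicount[OF fU fE], rule ballI)
    fix e assume e: "e \<in> induced_edges E U"
    then have "e \<in> E" "e \<subseteq> U" by (auto simp: induced_edges_def)
    then obtain x y where "x \<noteq> y" "e = {x, y}" using assms by (auto simp: simple_graph_def)
    then have "{i \<in> U. i \<in> e} = {x, y}" using \<open>e \<subseteq> U\<close> by auto
    then show "card {i \<in> U. i \<in> e} = 2" using \<open>x \<noteq> y\<close> by simp
  qed
  finally show ?thesis .
qed

lemma sum_card_nbs_le_mad:
  assumes G: "simple_graph V E" and "U \<subseteq> V" "U \<noteq> {}"
  shows "real (\<Sum>v\<in>U. card (nbs E U v)) \<le> mad V E * real (card U)"
proof -
  let ?A = "{2 * real (card E') / real (card V') | V' E'. subgraph V' E' V E \<and> V' \<noteq> {}}"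
  have fV: "finite V" using G by (simp add: simple_graph_def)
  have "E \<subseteq> Pow V" using G by (auto simp: simple_graph_def)
  then have fE: "finite E" using fV by (meson finite_Pow_iff finite_subset)
  \<comment> \<open>\<open>Max\<close> yields an upper bound only on a finite set; the pairs of
    subsets of \<open>V\<close> and \<open>E\<close> are finitely many.\<close>
  have "?A \<subseteq> (\<lambda>(V', E'). 2 * real (card E') / real (card V')) ` (Pow V \<times> Pow E)"
    by (force simp: subgraph_def)
  then have "finite ?A" by (rule finite_subset) (simp add: fV fE)
  moreover have "2 * real (card (induced_edges E U)) / real (card U) \<in> ?A"
    using assms by (auto simp: subgraph_def induced_edges_def)
  ultimately have "2 * real (card (induced_edges E U)) / real (card U) \<le> mad V E"
    using assms by (auto simp: mad_def intro: Max_ge)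
  moreover have "card U > 0"
    using assms fV finite_subset by (auto simp: card_gt_0_iff)
  ultimately show ?thesis
    using sum_card_nbs[OF G \<open>U \<subseteq> V\<close>] by (simp add: field_simps)
qed

text \<open>Every vertex \<open>w\<close> gives charge \<open>h (deg w)\<close> to each of its neighbours of degree 2.\<close>

lemma discharging:
  fixes h :: "nat \<Rightarrow> real" and s :: real
  assumes "finite U"
    and d: "\<And>v. d v = card (nbs E U v)"
    and "h 2 = 0"
    and "\<And>v. v \<in> U \<Longrightarrow> 2 \<le> d v"
    and two: "\<And>v. v \<in> U \<Longrightarrow> d v = 2 \<Longrightarrow> s \<le> 2 + (\<Sum>w\<in>nbs E U v. h (d w))"
    and big: "\<And>v. v \<in> U \<Longrightarrow> 3 \<le> d v \<Longrightarrow>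
      s + real (card {w \<in> nbs E U v. d w = 2}) * h (d v) \<le> real (d v)"
  shows "s * real (card U) \<le> real (\<Sum>v\<in>U. d v)"
proof -
  let ?out = "\<lambda>v. \<Sum>w\<in>nbs E U v. if d w = 2 then h (d v) else 0"
  let ?in = "\<lambda>v. \<Sum>w\<in>nbs E U v. if d v = 2 then h (d w) else 0"
  have out: "?out v = real (card {w \<in> nbs E U v. d w = 2}) * h (d v)" for v
    by (simp add: sum.If_cases finite_nbs[OF \<open>finite U\<close>] Int_def)
  \<comment> \<open>Charge sent and charge received agree in total: both sum over the adjacent pairs
    with a receiver of degree 2.\<close>
  have "sum ?in U = sum ?out U"
    unfolding nbs_def
    by (subst sum.swap_restrict[OF \<open>finite U\<close> \<open>finite U\<close>]) (simp add: insert_commute)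
  \<comment> \<open>A vertex of degree 2 sends nothing, as \<open>h 2 = 0\<close>; a larger one
    receives nothing.\<close>
  moreover have "s + ?out v \<le> real (d v) + ?in v" if v: "v \<in> U" for v
  proof (cases "d v = 2")
    case True
    then show ?thesis using two[OF v True] out[of v] \<open>h 2 = 0\<close> by simp
  next
    case False
    then have "3 \<le> d v" using assms(4)[OF v] by simp
    then show ?thesis using big[OF v] out[of v] False by simp
  qed
  then have "(\<Sum>v\<in>U. s + ?out v) \<le> (\<Sum>v\<in>U. real (d v) + ?in v)"
    by (rule sum_mono)
  ultimately show ?thesis
    by (simp add: sum.distrib mult.commute)
qed

section \<open>Counting forbidden colours\<close>

text \<open>\<open>Q\<close> stands for the ceiling of \<open>M / (k - 1)\<close>; the product form
  avoids division.\<close>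

locale bounded_degree_graph =
  fixes V :: "'a set" and E :: "'a set set" and M k Q :: nat
  assumes simple: "simple_graph V E"
    and max_degree: "max_degree_le V E M"
    and k_ge_4: "4 \<le> k"
    and M_le: "M \<le> Q * (k - 1)"
begin

lemma finite_V: "finite V"
  using simple by (simp add: simple_graph_def)

lemma finite_subset_V: "W \<subseteq> V \<Longrightarrow> finite W"
  using finite_V by (rule rev_finite_subset)

lemma no_loop: "{v} \<notin> E"
  using simple by (force simp: simple_graph_def)

lemma nbs_le_max_degree:
  assumes "v \<in> V" "W \<subseteq> V"
  shows "card (nbs E W v) \<le> M"
proof -
  \<comment> \<open>\<open>degree\<close> counts over the whole type, so finiteness has to come from
    the edges lying inside \<open>V\<close>.\<close>
  have "{u. {u, v} \<in> E} \<subseteq> V"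
    using simple by (auto simp: simple_graph_def doubleton_eq_iff)
  then have "finite {u. {u, v} \<in> E}"
    using finite_V by (rule finite_subset)
  then have "card (nbs E W v) \<le> degree E v"
    unfolding degree_def by (intro card_mono) (auto simp: nbs_def)
  then show ?thesis using max_degree assms by (force simp: max_degree_le_def)
qed

text \<open>The uncoloured \<open>v\<close> is one of the at most \<open>M\<close> neighbours of
  \<open>u\<close>, so fewer than \<open>Q * (k - 1)\<close> are coloured.\<close>

lemma card_saturated_less:
  assumes "insert v W \<subseteq> V" "v \<notin> W" "u \<in> nbs E W v"
  shows "card (saturated k E W c u) < Q"
proof -
  have fin: "finite W" using assms by (intro finite_subset_V) blast
  have "nbs E (insert v W) u = insert v (nbs E W u)" "v \<notin> nbs E W u"
    using assms by (auto simp: nbs_def insert_commute)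
  then have "card (nbs E (insert v W) u) = Suc (card (nbs E W u))"
    using finite_nbs[OF fin] by (simp add: card_insert_disjoint)
  moreover have "u \<in> V" using assms by (auto simp: nbs_def)
  then have "card (nbs E (insert v W) u) \<le> M"
    using assms(1) by (rule nbs_le_max_degree)
  ultimately have "card (nbs E W u) < M" by linarith
  moreover have "card (saturated k E W c u) * (k - 1) \<le> card (nbs E W u)"
    using k_ge_4 fin by (intro card_saturated_mult_le) auto
  ultimately have "card (saturated k E W c u) * (k - 1) < Q * (k - 1)"
    using M_le by linarith
  then show ?thesis by simp
qed

text \<open>Since \<open>k - 1 \<ge> 3\<close>, each saturated colour uses up three neighbours; a
  vertex with at most two coloured neighbours has none.\<close>

lemma three_card_saturated_le:
  assumes "finite W"
  shows "3 * card (saturated k E W c u) \<le> card (nbs E W u)"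
proof -
  have "card (saturated k E W c u) * 3 \<le> card (saturated k E W c u) * (k - 1)"
    using k_ge_4 by (intro mult_le_mono) auto
  also have "\<dots> \<le> card (nbs E W u)"
    using k_ge_4 assms by (intro card_saturated_mult_le) auto
  finally show ?thesis by simp
qed

text \<open>\<open>forested_coloring\<close> looks only at edges inside \<open>U\<close>, so this
  concerns the induced subgraph although \<open>E\<close> is kept.\<close>

definition colorable :: "('a \<Rightarrow> 'c set) \<Rightarrow> 'a set \<Rightarrow> bool" where
  "colorable L U \<longleftrightarrow> (\<exists>c. forested_coloring k U E c \<and> (\<forall>v\<in>U. c v \<in> L v))"

lemma card_forbidden_le:
  assumes "insert v W \<subseteq> V" "v \<notin> W"
  shows "finite (\<Union>u \<in> nbs E W v. insert (c u) (saturated k E W c u))"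
    and "card (\<Union>u \<in> nbs E W v. insert (c u) (saturated k E W c u)) \<le> card (nbs E W v) * Q"
proof -
  have fin: "finite W" using assms by (intro finite_subset_V) blast
  have finS: "finite (saturated k E W c u)" for u
    using k_ge_4 fin by (intro finite_saturated) auto
  show "finite (\<Union>u \<in> nbs E W v. insert (c u) (saturated k E W c u))"
    by (simp add: finite_nbs fin finS)
  have "card (insert (c u) (saturated k E W c u)) \<le> Q" if "u \<in> nbs E W v" for u
    using card_saturated_less[OF assms that, of c] by (simp add: card_insert_if finS)
  then have "card (\<Union>u \<in> nbs E W v. insert (c u) (saturated k E W c u)) \<le> (\<Sum>u\<in>nbs E W v. Q)"
    by (intro order.trans[OF card_UN_le] sum_mono) (auto simp: finite_nbs fin)
  then show "card (\<Union>u \<in> nbs E W v. insert (c u) (saturated k E W c u)) \<le> card (nbs E W v) * Q"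
    by simp
qed

section \<open>Reducible configurations\<close>

lemma reduce_degree_le_1:
  assumes "U \<subseteq> V" "v \<in> U" "card (nbs E U v) \<le> 1" "Q < card (L v)"
    and "colorable L (U - {v})"
  shows "colorable L U"
proof -
  let ?W = "U - {v}"
  obtain c where c: "forested_coloring k ?W E c" "\<forall>x\<in>?W. c x \<in> L x"
    using assms(5) by (auto simp: colorable_def)
  have fin: "finite ?W" using assms by (intro finite_subset_V) blast
  have N: "nbs E ?W v = nbs E U v" using no_loop[of v] by (auto simp: nbs_def)
  let ?F = "\<Union>u \<in> nbs E ?W v. insert (c u) (saturated k E ?W c u)"
  have vW: "insert v ?W \<subseteq> V" "v \<notin> ?W" using assms by auto
  note F = card_forbidden_le[OF vW, of c]
  have "card (nbs E ?W v) * Q \<le> 1 * Q"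
    unfolding N using assms(3) by (rule mult_le_mono1)
  then have "card ?F < card (L v)" using F(2) assms(4) by linarith
  then obtain a where a: "a \<in> L v" "a \<notin> ?F"
    using F(1) by (meson card_mono not_less subsetI)
  have "forested_coloring k (insert v ?W) E (c(v := a))"
    using c(1) fin no_loop k_ge_4 assms(3) a(2)
    by (intro forested_extend_degree_le_1) (auto simp: N)
  then show ?thesis
    using a(1) c(2) assms(2) by (auto simp: colorable_def insert_absorb intro!: exI[of _ "c(v := a)"])
qed

text \<open>Without \<open>v\<close>, at most two neighbours of \<open>w\<close> remain, so
  \<open>w\<close> has no saturated colour. Neighbours of different colours then forbid at most
  \<open>s + 2\<close> colours; neighbours of equal colour forbid at most \<open>1 + s\<close> and
  the \<open>card (nbs E U w) - 1\<close> colours around \<open>w\<close>.\<close>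

lemma reduce_degree_2:
  assumes U: "U \<subseteq> V" "v \<in> U" and N: "nbs E U v = {u, w}" "u \<noteq> w"
    and s: "\<And>c :: 'a \<Rightarrow> 'c. card (saturated k E (U - {v}) c u) \<le> s"
    and w: "card (nbs E U w) \<le> 3"
    and L: "s + 2 < card (L v)" "s + card (nbs E U w) < card (L v)"
    and "colorable (L :: 'a \<Rightarrow> 'c set) (U - {v})"
  shows "colorable L U"
proof -
  let ?W = "U - {v}"
  obtain c where c: "forested_coloring k ?W E c" "\<forall>x\<in>?W. c x \<in> L x"
    using assms(9) by (auto simp: colorable_def)
  have fin: "finite ?W" using U by (intro finite_subset_V) blast
  have N': "nbs E ?W v = {u, w}" using N no_loop[of v] by (auto simp: nbs_def)
  have "nbs E U w = insert v (nbs E ?W w)" "v \<notin> nbs E ?W w"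
    using N U by (auto simp: nbs_def insert_commute doubleton_eq_iff)
  then have cw: "card (nbs E U w) = Suc (card (nbs E ?W w))"
    using finite_nbs[OF fin] by (simp add: card_insert_disjoint)
  then have "card (saturated k E ?W c w) = 0"
    using three_card_saturated_le[OF fin, of c w] w by simp
  then have "if c u = c w then 1 + card (saturated k E ?W c u) + card (nbs E ?W w) < card (L v)
      else 2 + card (saturated k E ?W c u) + card (saturated k E ?W c w) < card (L v)"
    using s[of c] L cw by auto
  then obtain a where "a \<in> L v" "forested_coloring k (insert v ?W) E (c(v := a))"
    using forested_extend_degree_2[OF c(1) fin _ no_loop _ N'] k_ge_4 by auto
  then show ?thesis
    using c(2) U by (auto simp: colorable_def insert_absorb intro!: exI[of _ "c(v := a)"])
qed

text \<open>The leaves are coloured one by one; each far neighbour has at most \<open>Q - 1\<close>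
  saturated colours. If its colour differs from that of \<open>w\<close>, these two colours and, by
  \<open>le\<close>, at most \<open>j - 2\<close> saturated at \<open>w\<close> are added; otherwise
  the common colour and, by \<open>alt\<close>, at most \<open>j - 1\<close> colours around
  \<open>w\<close>. Either way at most \<open>Q + j - 1\<close> colours are forbidden.\<close>

lemma forested_extend_leaves:
  assumes V: "X \<subseteq> V" "T \<subseteq> V" "X \<inter> T = {}" and w: "w \<in> X"
    and N: "\<And>v. v \<in> T \<Longrightarrow> nbs E (X \<union> T) v = {w, f v}"
    and f: "\<And>v. v \<in> T \<Longrightarrow> f v \<in> X"
    and L: "\<And>v. v \<in> T \<Longrightarrow> Q + j \<le> card (L v)"
    and c: "forested_coloring k X E c" "\<And>v. v \<in> X \<Longrightarrow> c v \<in> L v"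
    and le: "card (nbs E X w) + card T \<le> 3 * (j - 1)"
    and alt: "(\<forall>v\<in>T. c (f v) \<noteq> c w) \<or> card (nbs E X w) + card T \<le> j"
  obtains c' where "forested_coloring k (X \<union> T) E c'" "\<And>v. v \<in> X \<union> T \<Longrightarrow> c' v \<in> L v"
    "\<And>v. v \<in> X \<Longrightarrow> c' v = c v"
proof -
  have "\<exists>c'. forested_coloring k (X \<union> T') E c' \<and> (\<forall>v\<in>X \<union> T'. c' v \<in> L v) \<and> (\<forall>v\<in>X. c' v = c v)"
    if "finite T'" "T' \<subseteq> T" for T'
    using that
  proof (induction T')
    case empty
    then show ?case using c by auto
  next
    case (insert v T')
    let ?Y = "X \<union> T'"
    obtain c' where c': "forested_coloring k ?Y E c'" "\<forall>v\<in>?Y. c' v \<in> L v" "\<forall>v\<in>X. c' v = c v"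
      using insert by auto
    have v: "v \<in> T" and vY: "insert v ?Y \<subseteq> V" "v \<notin> ?Y"
      using insert V by auto
    have fin: "finite ?Y" "finite T"
      using vY V by (intro finite_subset_V; blast)+
    have "nbs E ?Y v = {w, f v} \<inter> ?Y"
      using N[OF v] insert.prems by (auto simp: nbs_def)
    then have NY: "nbs E ?Y v = {f v, w}" using f[OF v] w by auto
    have "card (nbs E ?Y w) \<le> card (nbs E X w \<union> T')"
      using fin by (intro card_mono) (auto simp: nbs_def)
    also have "\<dots> \<le> card (nbs E X w) + card T'" by (rule card_Un_le)
    finally have "card (nbs E ?Y w) \<le> card (nbs E X w) + card T'" .
    moreover have "card (insert v T') \<le> card T"
      using insert.prems fin by (intro card_mono) auto
    \<comment> \<open>Strict because the leaf \<open>v\<close> itself is still uncoloured.\<close>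
    ultimately have w_le: "card (nbs E ?Y w) < card (nbs E X w) + card T"
      using insert.hyps by simp
    have s1: "card (saturated k E ?Y c' (f v)) < Q"
      using card_saturated_less[OF vY, of "f v"] NY by auto
    have s2: "3 * card (saturated k E ?Y c' w) \<le> card (nbs E ?Y w)"
      using three_card_saturated_le fin by blast
    have "if c' (f v) = c' w then 1 + card (saturated k E ?Y c' (f v)) + card (nbs E ?Y w) < card (L v)
      else 2 + card (saturated k E ?Y c' (f v)) + card (saturated k E ?Y c' w) < card (L v)"
    proof (cases "c' (f v) = c' w")
      case True
      then have "card (nbs E X w) + card T \<le> j"
        using alt c'(3) f[OF v] v w by auto
      then show ?thesis using True w_le s1 L[OF v] by simp
    next
      case False
      have "3 * card (saturated k E ?Y c' w) < 3 * (j - 1)"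
        using s2 w_le le by linarith
      then show ?thesis using False s1 L[OF v] by simp
    qed
    then obtain a where a: "a \<in> L v" "forested_coloring k (insert v ?Y) E (c'(v := a))"
      using forested_extend_degree_2[OF c'(1) fin(1) vY(2) no_loop _ NY] k_ge_4 by auto
    have "forested_coloring k (X \<union> insert v T') E (c'(v := a))" using a(2) by simp
    moreover have "\<forall>x\<in>X \<union> insert v T'. (c'(v := a)) x \<in> L x" using c'(2) a(1) by auto
    moreover have "\<forall>x\<in>X. (c'(v := a)) x = c x" using c'(3) vY(2) by auto
    ultimately show ?case by (intro exI[of _ "c'(v := a)"] conjI)
  qed
  from this[OF finite_subset_V[OF V(2)] subset_refl] obtain c'
    where "forested_coloring k (X \<union> T) E c'" "\<forall>v\<in>X \<union> T. c' v \<in> L v" "\<forall>v\<in>X. c' v = c v"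
    by (elim exE conjE)
  then show thesis by (intro that[of c']) auto
qed

text \<open>
  The centre \<open>w\<close> is recoloured first, avoiding the colours of the far neighbours of the leaves in \<open>B\<close>.
  The other leaves come next, while \<open>w\<close> still has few coloured neighbours; the leaves in \<open>B\<close>
  come last, as they can no longer close a bicoloured cycle.
\<close>

lemma reduce_star:
  assumes U: "U \<subseteq> V" "w \<in> U" and T: "T \<subseteq> nbs E U w" "card (nbs E U w) \<le> card T + 1"
    and two: "\<And>v. v \<in> T \<Longrightarrow> card (nbs E U v) = 2"
    and indep: "\<And>v. v \<in> T \<Longrightarrow> nbs E U v \<inter> T = {}"
    and L: "\<And>v. v \<in> insert w T \<Longrightarrow> Q + j \<le> card (L v)"
    and D: "card (nbs E U w) < 2 * j" "card (nbs E U w) \<le> 3 * (j - 1)"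
    and "colorable L (U - insert w T)"
  shows "colorable L U"
proof -
  let ?W = "U - insert w T" and ?D = "card (nbs E U w)"
  let ?X = "insert w ?W"
  have finU: "finite U" using U by (intro finite_subset_V) blast
  have wT: "w \<notin> T" and TU: "T \<subseteq> U" using T no_loop[of w] by (auto simp: nbs_def)
  have finT: "finite T" using TU finU by (rule finite_subset)
  obtain c where c: "forested_coloring k ?W E c" "\<forall>x\<in>?W. c x \<in> L x"
    using assms(10) by (auto simp: colorable_def)
  have "\<exists>u. nbs E U v = {w, u} \<and> u \<in> ?W" if v: "v \<in> T" for v
  proof -
    have "w \<in> nbs E U v" using v T U by (auto simp: nbs_def insert_commute)
    then obtain u where "nbs E U v = {w, u}" "u \<noteq> w"
      using card_2_memE[OF two[OF v]] by blast
    moreover have "u \<in> U" using calculation by (auto simp: nbs_def)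
    ultimately show ?thesis using indep[OF v] by auto
  qed
  then obtain f where f: "\<And>v. v \<in> T \<Longrightarrow> nbs E U v = {w, f v}" "\<And>v. v \<in> T \<Longrightarrow> f v \<in> ?W"
    by metis
  have Z: "nbs E ?W w = nbs E U w - T" "nbs E ?X w = nbs E U w - T"
    using no_loop[of w] by (auto simp: nbs_def)
  have card_Z: "card (nbs E U w - T) + card T = ?D"
    using T(1) finU by (metis card_Diff_subset card_mono finT finite_nbs le_add_diff_inverse2)
  \<comment> \<open>The size of \<open>B\<close> is below \<open>j\<close>, so \<open>w\<close> can
    avoid the far colours of \<open>B\<close>, yet at most \<open>j\<close> neighbours of
    \<open>w\<close> are coloured once the other leaves are. Truncated subtraction makes
    \<open>B\<close> empty if \<open>?D \<le> j\<close>.\<close>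
  have "?D - j \<le> card T" using T D by linarith
  then obtain B where B: "B \<subseteq> T" "card B = ?D - j" "finite B"
    using obtain_subset_with_card_n by metis
  let ?F = "\<Union>u \<in> nbs E ?W w. insert (c u) (saturated k E ?W c u)"
  have wW: "insert w ?W \<subseteq> V" "w \<notin> ?W" using U by auto
  note F = card_forbidden_le[OF wW, of c]
  have Z1: "card (nbs E ?W w) \<le> 1" using Z card_Z T by simp
  then have "card (nbs E ?W w) * Q \<le> 1 * Q" by (rule mult_le_mono1)
  then have "card ?F \<le> Q" using F(2) by linarith
  moreover have "card (c ` f ` B) \<le> ?D - j"
    using B card_image_le[of "f ` B" c] card_image_le[of B f] by simp
  ultimately have "card (?F \<union> c ` f ` B) < Q + j"
    using card_Un_le[of ?F "c ` f ` B"] D by linarith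
  then have "card (?F \<union> c ` f ` B) < card (L w)" using L[of w] by simp
  then obtain a where a: "a \<in> L w" "a \<notin> ?F" "a \<notin> c ` f ` B"
    using F(1) B(3) by (metis (no_types, lifting) UnCI card_mono finite_UnI finite_imageI not_less subsetI)
  let ?c = "c(w := a)"
  have X: "forested_coloring k ?X E ?c"
    using c(1) finU no_loop k_ge_4 Z1 a(2) by (intro forested_extend_degree_le_1) auto
  let ?A = "T - B"
  have cardAB: "card ?A + card B = card T"
    using B finT by (metis card_Diff_subset card_mono le_add_diff_inverse2)
  have N: "nbs E Y v = {w, f v}" if "v \<in> T" "?X \<subseteq> Y" "Y \<subseteq> U" for v Y
  proof -
    have "nbs E Y v = nbs E U v \<inter> Y" using that by (auto simp: nbs_def)
    then show ?thesis using f that by auto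
  qed
  obtain c1 where c1: "forested_coloring k (?X \<union> ?A) E c1" "\<And>v. v \<in> ?X \<union> ?A \<Longrightarrow> c1 v \<in> L v"
    "\<And>v. v \<in> ?X \<Longrightarrow> c1 v = ?c v"
  proof (rule forested_extend_leaves[of ?X ?A w f j L ?c])
    \<comment> \<open>These leaves may have a far neighbour coloured like \<open>w\<close>, so the
      second alternative is established; for \<open>B\<close> it will be the first.\<close>
    show "(\<forall>v\<in>?A. ?c (f v) \<noteq> ?c w) \<or> card (nbs E ?X w) + card ?A \<le> j"
      "card (nbs E ?X w) + card ?A \<le> 3 * (j - 1)"
      unfolding Z using card_Z cardAB B(2) D by linarith+
    show "nbs E (?X \<union> ?A) v = {w, f v}" if "v \<in> ?A" for v
      using that U TU by (intro N) auto
  qed (use U TU wT f L X c(2) a(1) in auto)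
  have "card (nbs E (?X \<union> ?A) w) \<le> card (nbs E U w - T \<union> ?A)"
    using finU finT no_loop[of w] by (intro card_mono) (auto simp: nbs_def)
  then have N1: "card (nbs E (?X \<union> ?A) w) + card B \<le> ?D"
    using card_Un_le[of "nbs E U w - T" ?A] card_Z cardAB by linarith
  obtain c2 where c2: "forested_coloring k (?X \<union> ?A \<union> B) E c2" "\<And>v. v \<in> ?X \<union> ?A \<union> B \<Longrightarrow> c2 v \<in> L v"
  proof (rule forested_extend_leaves[of "?X \<union> ?A" B w f j L c1])
    have "c1 (f v) \<noteq> c1 w" if "v \<in> B" for v
    proof -
      have "f v \<in> ?W" using f that B by auto
      then show ?thesis using c1(3)[of "f v"] c1(3)[of w] that a(3) by (auto simp: image_iff)
    qed
    then show "(\<forall>v\<in>B. c1 (f v) \<noteq> c1 w) \<or> card (nbs E (?X \<union> ?A) w) + card B \<le> j" by blast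
    show "f v \<in> ?X \<union> ?A" if "v \<in> B" for v using f(2) that B by blast
    show "nbs E (?X \<union> ?A \<union> B) v = {w, f v}" if "v \<in> B" for v
      using that B U TU by (intro N) auto
    show "card (nbs E (?X \<union> ?A) w) + card B \<le> 3 * (j - 1)" using N1 D by linarith
  qed (use U TU wT B L c1 in auto)
  moreover have "?X \<union> ?A \<union> B = U" using U TU B by auto
  ultimately show ?thesis by (auto simp: colorable_def)
qed

section \<open>Minimal counterexamples and the three discharging rules\<close>

text \<open>Strong induction on subsets makes \<open>U\<close> a minimal counterexample; by
  \<open>step\<close> its average degree is at least \<open>s\<close>, which exceeds
  \<open>mad V E\<close>.\<close>

lemma colorable_by_discharging:
  assumes "mad V E < s"
    and step: "\<And>U. U \<subseteq> V \<Longrightarrow> (\<And>W. W \<subset> U \<Longrightarrow> colorable L W) \<Longrightarrow> \<not> colorable L U \<Longrightarrow>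
      s * real (card U) \<le> real (\<Sum>v\<in>U. card (nbs E U v))"
  shows "colorable L V"
proof -
  have "colorable L U" if "finite U" "U \<subseteq> V" for U
    using that
  proof (induction rule: finite_psubset_induct)
    case (psubset U)
    show ?case
    proof (cases "U = {}")
      case True
      then show ?thesis
        by (simp add: colorable_def forested_coloring_def proper_coloring_def forest_def is_cycle_def)
    next
      case False
      show ?thesis
      proof (rule ccontr)
        assume "\<not> colorable L U"
        then have "s * real (card U) \<le> real (\<Sum>v\<in>U. card (nbs E U v))"
          using psubset by (intro step) auto
        also have "\<dots> \<le> mad V E * real (card U)"
          using simple psubset.prems False by (rule sum_card_nbs_le_mad)
        finally show False
          using assms(1) False psubset.hyps by (simp add: mult_le_cancel_right card_gt_0_iff)
      qed
    qed
  qed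
  then show ?thesis using finite_V by blast
qed

lemma colorable_mad_less_12_5:
  fixes L :: "'a \<Rightarrow> 'c set"
  assumes mad: "mad V E < 12 / 5" and L: "\<And>v. v \<in> V \<Longrightarrow> Q + 1 \<le> card (L v)" and "2 \<le> Q"
  shows "colorable L V"
proof (rule colorable_by_discharging[OF mad])
  fix U assume U: "U \<subseteq> V" and IH: "\<And>W. W \<subset> U \<Longrightarrow> colorable L W" and nc: "\<not> colorable L U"
  let ?d = "\<lambda>v. card (nbs E U v)"
  \<comment> \<open>A 2-vertex lacks \<open>2 / 5\<close>: either a neighbour of degree at least 4
    supplies all of it, or two neighbours of degree at least 3 supply at least half each. Degrees 3
    and 4 can just afford to pay all their neighbours.\<close>
  let ?h = "\<lambda>d::nat. if d \<le> 2 then 0 else if d = 3 then 1 / 5 else 2 / 5 :: real"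
  have fin: "finite U" using U by (intro finite_subset_V) blast
  show "12 / 5 * real (card U) \<le> real (\<Sum>v\<in>U. ?d v)"
  proof (rule discharging[OF fin refl, where h = ?h])
    show min2: "2 \<le> ?d v" if v: "v \<in> U" for v
    proof (rule ccontr)
      assume "\<not> 2 \<le> ?d v"
      then have "colorable L U"
        using IH[of "U - {v}"] L[of v] U v by (intro reduce_degree_le_1[of U v L]) auto
      then show False using nc by simp
    qed
    show "12 / 5 \<le> 2 + (\<Sum>w\<in>nbs E U v. ?h (?d w))" if v: "v \<in> U" "?d v = 2" for v
    proof -
      obtain u w where N: "nbs E U v = {u, w}" "u \<noteq> w"
        using v by (auto simp: card_2_iff)
      have reducible: False if N: "nbs E U v = {x, y}" "x \<noteq> y" and "?d y = 2" "?d x \<le> 3" for x y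
      proof -
        have fin': "finite (U - {v})" using fin by simp
        have "nbs E U x = insert v (nbs E (U - {v}) x)" "v \<notin> nbs E (U - {v}) x"
          using N v by (auto simp: nbs_def insert_commute doubleton_eq_iff)
        then have "card (nbs E (U - {v}) x) < 3"
          using \<open>?d x \<le> 3\<close> by (simp add: finite_nbs fin)
        then have "card (saturated k E (U - {v}) c x) \<le> 0" for c :: "'a \<Rightarrow> 'c"
          using three_card_saturated_le[OF fin', of c x] by simp
        \<comment> \<open>Here \<open>s = 0\<close>, so at most two colours are forbidden, while
          \<open>2 \<le> Q\<close> gives lists of at least three.\<close>
        then have "colorable L U"
          using U v N IH[of "U - {v}"] L[of v] \<open>2 \<le> Q\<close> \<open>?d y = 2\<close>
          by (intro reduce_degree_2[of U v x y 0 L]) auto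
        then show False using nc by simp
      qed
      have "u \<in> U" "w \<in> U" using N by (auto simp: nbs_def)
      then show ?thesis
        using N reducible[of u w] reducible[of w u] min2[of u] min2[of w]
        by (auto simp: insert_commute)
    qed
    show "12 / 5 + real (card {w \<in> nbs E U v. ?d w = 2}) * ?h (?d v) \<le> real (?d v)"
      if v: "v \<in> U" "3 \<le> ?d v" for v
    proof -
      have "card {w \<in> nbs E U v. ?d w = 2} \<le> ?d v"
        by (intro card_mono) (auto simp: finite_nbs fin)
      then show ?thesis using v by auto
    qed
  qed simp
qed

text \<open>The other neighbour \<open>u\<close> has at most \<open>Q - 1\<close> saturated colours,
  so \<open>reduce_degree_2\<close> applies with \<open>s = Q - 1\<close>; \<open>j \<le> 3\<close>
  keeps \<open>w\<close> small enough for it.\<close>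

lemma degree_2_reducible:
  fixes L :: "'a \<Rightarrow> 'c set"
  assumes U: "U \<subseteq> V" and IH: "\<And>W. W \<subset> U \<Longrightarrow> colorable L W"
    and L: "\<And>v. v \<in> V \<Longrightarrow> Q + j \<le> card (L v)"
    and v: "v \<in> U" "card (nbs E U v) = 2" "w \<in> nbs E U v"
    and j: "card (nbs E U w) \<le> j" "2 \<le> j" "j \<le> 3"
  shows "colorable L U"
proof -
  obtain u where N: "nbs E U v = {u, w}" "u \<noteq> w"
    using card_2_memE[OF v(2,3)] by (metis insert_commute)
  have vU: "insert v (U - {v}) \<subseteq> V" "v \<notin> U - {v}" using U v by auto
  have "u \<in> nbs E (U - {v}) v" using N no_loop[of v] by (auto simp: nbs_def)
  then have s: "card (saturated k E (U - {v}) c u) < Q" for c :: "'a \<Rightarrow> 'c"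
    by (rule card_saturated_less[OF vU])
  \<comment> \<open>Ensures that \<open>Q - 1\<close> is not truncated.\<close>
  then have "Q \<ge> 1" using not_less_zero by (metis less_one not_le)
  have "card (saturated k E (U - {v}) c u) \<le> Q - 1" for c :: "'a \<Rightarrow> 'c"
    using s[of c] by simp
  then show ?thesis
    using U v N IH[of "U - {v}"] L[of v] j \<open>Q \<ge> 1\<close>
    by (intro reduce_degree_2[of U v u w "Q - 1" L]) auto
qed

text \<open>The leaves are all 2-neighbours of \<open>w\<close>. Two adjacent ones would already be
  reducible by \<open>degree_2_reducible\<close>, which gives the independence required by
  \<open>reduce_star\<close>.\<close>

lemma star_reducible:
  assumes U: "U \<subseteq> V" and IH: "\<And>W. W \<subset> U \<Longrightarrow> colorable L W"
    and L: "\<And>v. v \<in> V \<Longrightarrow> Q + j \<le> card (L v)"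
    and w: "w \<in> U" "card (nbs E U w) \<le> card {v \<in> nbs E U w. card (nbs E U v) = 2} + 1"
    and D: "card (nbs E U w) < 2 * j" "card (nbs E U w) \<le> 3 * (j - 1)" and j: "2 \<le> j" "j \<le> 3"
  shows "colorable L U"
proof (rule ccontr)
  assume nc: "\<not> colorable L U"
  let ?T = "{v \<in> nbs E U w. card (nbs E U v) = 2}"
  have "nbs E U v \<inter> ?T = {}" if "v \<in> ?T" for v
  proof (rule ccontr)
    assume "nbs E U v \<inter> ?T \<noteq> {}"
    then obtain x where "x \<in> nbs E U v" "card (nbs E U x) = 2" by auto
    moreover have "v \<in> U" "card (nbs E U v) = 2" using that by (auto simp: nbs_def)
    ultimately have "colorable L U"
      using j by (intro degree_2_reducible[OF U IH L]) auto
    then show False using nc by simp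
  qed
  moreover have "?T \<subseteq> U" by (auto simp: nbs_def)
  ultimately have "colorable L U"
    using U w D L by (intro reduce_star[of U w ?T j L] IH) auto
  then show False using nc by simp
qed

lemma colorable_mad_less_8_3:
  assumes mad: "mad V E < 8 / 3" and L: "\<And>v. v \<in> V \<Longrightarrow> Q + 2 \<le> card (L v)"
  shows "colorable L V"
proof (rule colorable_by_discharging[OF mad])
  fix U assume U: "U \<subseteq> V" and IH: "\<And>W. W \<subset> U \<Longrightarrow> colorable L W" and nc: "\<not> colorable L U"
  let ?d = "\<lambda>v. card (nbs E U v)"
  \<comment> \<open>Both neighbours of a 2-vertex have degree at least 3, and together they supply
    the missing \<open>2 / 3\<close>. A 3-vertex can pay only once, hence the star argument; from
    degree 4 on all neighbours can be paid.\<close>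
  let ?h = "\<lambda>d::nat. if d \<le> 2 then 0 else 1 / 3 :: real"
  have fin: "finite U" using U by (intro finite_subset_V) blast
  show "8 / 3 * real (card U) \<le> real (\<Sum>v\<in>U. ?d v)"
  proof (rule discharging[OF fin refl, where h = ?h])
    show min2: "2 \<le> ?d v" if v: "v \<in> U" for v
    proof (rule ccontr)
      assume "\<not> 2 \<le> ?d v"
      then have "colorable L U"
        using IH[of "U - {v}"] L[of v] U v by (intro reduce_degree_le_1[of U v L]) auto
      then show False using nc by simp
    qed
    show "8 / 3 \<le> 2 + (\<Sum>w\<in>nbs E U v. ?h (?d w))" if v: "v \<in> U" "?d v = 2" for v
    proof -
      obtain u w where "nbs E U v = {u, w}" "u \<noteq> w"
        using v by (auto simp: card_2_iff)
      moreover have "\<not> ?d x \<le> 2" if "x \<in> nbs E U v" for x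
        using degree_2_reducible[OF U IH L v that] nc by auto
      ultimately show ?thesis by auto
    qed
    show "8 / 3 + real (card {w \<in> nbs E U v. ?d w = 2}) * ?h (?d v) \<le> real (?d v)"
      if v: "v \<in> U" "3 \<le> ?d v" for v
    proof -
      have "card {w \<in> nbs E U v. ?d w = 2} \<le> ?d v"
        by (intro card_mono) (auto simp: finite_nbs fin)
      moreover have "card {w \<in> nbs E U v. ?d w = 2} + 1 < ?d v" if "?d v = 3"
        using star_reducible[OF U IH L v(1)] that nc by force
      ultimately show ?thesis using v by (cases "?d v = 3") auto
    qed
  qed simp
qed

lemma colorable_mad_less_3:
  assumes mad: "mad V E < 3" and L: "\<And>v. v \<in> V \<Longrightarrow> Q + 3 \<le> card (L v)"
  shows "colorable L V"
proof (rule colorable_by_discharging[OF mad])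
  fix U assume U: "U \<subseteq> V" and IH: "\<And>W. W \<subset> U \<Longrightarrow> colorable L W" and nc: "\<not> colorable L U"
  let ?d = "\<lambda>v. card (nbs E U v)"
  \<comment> \<open>Both neighbours of a 2-vertex have degree at least 4 and give half a unit each.
    From degree 6 on all neighbours can be paid; degrees 4 and 5 need the two unpaid neighbours
    found by the star argument.\<close>
  let ?h = "\<lambda>d::nat. if d \<le> 3 then 0 else 1 / 2 :: real"
  have fin: "finite U" using U by (intro finite_subset_V) blast
  show "3 * real (card U) \<le> real (\<Sum>v\<in>U. ?d v)"
  proof (rule discharging[OF fin refl, where h = ?h])
    show min2: "2 \<le> ?d v" if v: "v \<in> U" for v
    proof (rule ccontr)
      assume "\<not> 2 \<le> ?d v"
      then have "colorable L U"
        using IH[of "U - {v}"] L[of v] U v by (intro reduce_degree_le_1[of U v L]) auto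
      then show False using nc by simp
    qed
    show "3 \<le> 2 + (\<Sum>w\<in>nbs E U v. ?h (?d w))" if v: "v \<in> U" "?d v = 2" for v
    proof -
      obtain u w where "nbs E U v = {u, w}" "u \<noteq> w"
        using v by (auto simp: card_2_iff)
      moreover have "\<not> ?d x \<le> 3" if "x \<in> nbs E U v" for x
        using degree_2_reducible[OF U IH L v that] nc by auto
      ultimately show ?thesis by auto
    qed
    show "3 + real (card {w \<in> nbs E U v. ?d w = 2}) * ?h (?d v) \<le> real (?d v)"
      if v: "v \<in> U" "3 \<le> ?d v" for v
    proof -
      define n where "n = card {w \<in> nbs E U v. ?d w = 2}"
      have n: "n \<le> ?d v"
        unfolding n_def by (intro card_mono) (auto simp: finite_nbs fin)
      have small: "n + 1 < ?d v" if "?d v \<le> 5"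
        using star_reducible[OF U IH L v(1)] that nc unfolding n_def by force
      consider "?d v = 3" | "?d v = 4" | "?d v = 5" | "6 \<le> ?d v" using v by linarith
      then have "3 + real n * ?h (?d v) \<le> real (?d v)"
        by cases (use n small in simp_all)
      then show ?thesis unfolding n_def .
    qed
  qed simp
qed

section \<open>From colourability to the choice number\<close>

lemma forested_choice_number_le:
  assumes "\<And>L :: 'a \<Rightarrow> nat set. (\<And>v. v \<in> V \<Longrightarrow> q \<le> card (L v)) \<Longrightarrow> colorable L V"
  shows "forested_choice_number k V E \<le> q"
  unfolding forested_choice_number_def
proof (rule Least_le)
  show "forested_choosable k V E q"
    unfolding forested_choosable_def forested_L_colorable_def
    using assms by (auto simp: colorable_def)
qed

end

theorem theorem1p2:
  fixes V :: "'a set" and E :: "'a set set" and M k :: nat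
  assumes "simple_graph V E"
    and "k \<ge> 4" and "M \<ge> k"
    and "max_degree_le V E M"
  shows "(mad V E < 12 / 5 \<longrightarrow>
            int (forested_choice_number k V E) \<le> \<lceil>real M / real (k - 1)\<rceil> + 1)
       \<and> (mad V E < 8 / 3 \<longrightarrow>
            int (forested_choice_number k V E) \<le> \<lceil>real M / real (k - 1)\<rceil> + 2)
       \<and> (mad V E < 3 \<longrightarrow>
            int (forested_choice_number k V E) \<le> \<lceil>real M / real (k - 1)\<rceil> + 3)"
proof -
  define Q where "Q = nat \<lceil>real M / real (k - 1)\<rceil>"
  have pos: "real (k - 1) > 0" using \<open>k \<ge> 4\<close> by simp
  \<comment> \<open>\<open>M \<ge> k\<close> makes the quotient exceed 1, hence
    \<open>2 \<le> Q\<close>, as the case of \<open>12 / 5\<close> requires.\<close>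
  have "real M / real (k - 1) > 1" using assms(2,3) pos by simp
  then have "2 \<le> \<lceil>real M / real (k - 1)\<rceil>" by (simp add: le_ceiling_iff)
  then have ceil: "\<lceil>real M / real (k - 1)\<rceil> = int Q" and "2 \<le> Q"
    by (simp_all add: Q_def le_nat_iff)
  have "real M / real (k - 1) \<le> real Q"
    using le_of_int_ceiling[of "real M / real (k - 1)"] unfolding ceil by simp
  then have "real M \<le> real (Q * (k - 1))" using pos by (simp add: pos_divide_le_eq)
  then have "M \<le> Q * (k - 1)" by linarith
  then interpret bounded_degree_graph V E M k Q
    using assms by unfold_locales auto
  have "forested_choice_number k V E \<le> Q + 1" if "mad V E < 12 / 5"
    using that \<open>2 \<le> Q\<close> by (intro forested_choice_number_le colorable_mad_less_12_5)
  moreover have "forested_choice_number k V E \<le> Q + 2" if "mad V E < 8 / 3"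
    using that by (intro forested_choice_number_le colorable_mad_less_8_3)
  moreover have "forested_choice_number k V E \<le> Q + 3" if "mad V E < 3"
    using that by (intro forested_choice_number_le colorable_mad_less_3)
  ultimately show ?thesis unfolding ceil by auto
qed

end
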